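(* Let $\phi$ be an $\mathsf{LTL}_f$ formula. Then $\phi$ is unsatisfiable if and only if there exist a conflict sequence $\mathcal{C}$ of $T_\phi$ and an integer $i\ge 0$ with $i+1<|\mathcal{C}|$ such that $\bigcap_{0\le j\le i}\mathcal{C}[j]\subseteq \mathcal{C}[i+1]$.
   Context: $\mathsf{LTL}_f$ is linear temporal logic interpreted over finite nonempty traces over a finite set $P$ of atoms; $\phi$ is satisfiable iff some finite nonempty trace satisfies it. $Tail$ denotes the formula that holds exactly at the last position of a trace. For a formula $\psi$, $\mathrm{xnf}(\psi)$ is its neXt normal form, an $\mathsf{LTL}_f$ formula equivalent to $\psi$ (possibly containing $Tail$) in which every temporal subformula occurs in the scope of a next operator $\mathsf{X}$; for a set $s$ of formulas, $\mathrm{xnf}(s)=\bigwedge_{\psi\in s}\mathrm{xnf}(\psi)$. For a formula $\theta$, $\theta^p$ is its propositional abstraction, obtained by treating each subformula of the form $\mathsf{X}\chi$ (and $Tail$) as a fresh Boolean variable. The transition system $T_\phi$ has as states finite sets of subformula-derived $\mathsf{LTL}_f$ formulas (each state read as the conjunction of its elements; there are finitely many reachable states), initial state $s_0=\{\phi\}$, and a transition $s\to s'$ whenever there is a satisfying assignment $A$ of $\mathrm{xnf}(s)^p$ with $s'=\{\chi : \text{the variable for } \mathsf{X}\chi \text{ is true in } A\}$; $s'$ is then a one-transition next state of $s$. A state $s$ is final iff $Tail\wedge \mathrm{xnf}(s)^p$ is satisfiable. It is a known property of $T_\phi$ that $\phi$ is satisfiable iff some run of $T_\phi$ from $s_0$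 ends in a final state. A conflict sequence for $T_\phi$ is a finite nonempty sequence $\mathcal{C}[0],\ldots,\mathcal{C}[|\mathcal{C}|-1]$ of sets of states of $T_\phi$ such that: (1) $s_0\in\mathcal{C}[i]$ for all $0\le i<|\mathcal{C}|$; (2) no state in $\mathcal{C}[0]$ is final; (3) for every $0\le i<|\mathcal{C}|-1$ and every $s\in\mathcal{C}[i+1]$, all one-transition next states of $s$ belong to $\mathcal{C}[i]$. *)

theory Defs
  imports Main
begin

(* Tail is a constructor, rather than the equivalent Neg (Next TT), because the
   propositional abstraction treats it as a Boolean variable of its own. *)
datatype (atoms: 'a) ltlf =
    TT
  | FF
  | Atom 'a
  | Tail
  | Neg "'a ltlf"
  | And "'a ltlf" "'a ltlf"
  | Or "'a ltlf" "'a ltlf"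
  | Next "'a ltlf"
  | WNext "'a ltlf"
  | Until "'a ltlf" "'a ltlf"
  | Release "'a ltlf" "'a ltlf"

(* Only meaningful on nonempty traces; every recursive call on a nonempty trace
   is made on a nonempty suffix.  Next is the strong and WNext the weak next. *)
primrec sat :: "'a set list \<Rightarrow> 'a ltlf \<Rightarrow> bool" where
  "sat \<xi> TT \<longleftrightarrow> True"
| "sat \<xi> FF \<longleftrightarrow> False"
| "sat \<xi> (Atom p) \<longleftrightarrow> p \<in> \<xi> ! 0"
| "sat \<xi> Tail \<longleftrightarrow> length \<xi> = 1"
| "sat \<xi> (Neg \<psi>) \<longleftrightarrow> \<not> sat \<xi> \<psi>"
| "sat \<xi> (And \<psi>\<^sub>1 \<psi>\<^sub>2) \<longleftrightarrow> sat \<xi> \<psi>\<^sub>1 \<and> sat \<xi> \<psi>\<^sub>2"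
| "sat \<xi> (Or \<psi>\<^sub>1 \<psi>\<^sub>2) \<longleftrightarrow> sat \<xi> \<psi>\<^sub>1 \<or> sat \<xi> \<psi>\<^sub>2"
| "sat \<xi> (Next \<psi>) \<longleftrightarrow> length \<xi> > 1 \<and> sat (drop 1 \<xi>) \<psi>"
| "sat \<xi> (WNext \<psi>) \<longleftrightarrow> (length \<xi> > 1 \<longrightarrow> sat (drop 1 \<xi>) \<psi>)"
| "sat \<xi> (Until \<psi>\<^sub>1 \<psi>\<^sub>2) \<longleftrightarrow>
     (\<exists>i<length \<xi>. sat (drop i \<xi>) \<psi>\<^sub>2 \<and> (\<forall>j<i. sat (drop j \<xi>) \<psi>\<^sub>1))"
| "sat \<xi> (Release \<psi>\<^sub>1 \<psi>\<^sub>2) \<longleftrightarrow>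
     (\<forall>i<length \<xi>. sat (drop i \<xi>) \<psi>\<^sub>2 \<or> (\<exists>j<i. sat (drop j \<xi>) \<psi>\<^sub>1))"

definition satisfiable :: "'a set \<Rightarrow> 'a ltlf \<Rightarrow> bool" where
  "satisfiable P \<phi> \<longleftrightarrow> (\<exists>\<xi>. \<xi> \<noteq> [] \<and> set \<xi> \<subseteq> Pow P \<and> sat \<xi> \<phi>)"

(* Negations are pushed inwards so that Next-subformulas occur only positively,
   and each strong (weak) next is guarded by Neg Tail (by Tail).  Both matter:
   a next state records only the true Next-variables, and finality of a state is
   tested with Tail and the Next-variables as independent Boolean variables. *)
fun xnf :: "'a ltlf \<Rightarrow> 'a ltlf" where
  "xnf TT = TT"
| "xnf FF = FF"
| "xnf (Atom p) = Atom p"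
| "xnf Tail = Tail"
| "xnf (And a b) = And (xnf a) (xnf b)"
| "xnf (Or a b) = Or (xnf a) (xnf b)"
| "xnf (Next a) = And (Neg Tail) (Next a)"
| "xnf (WNext a) = Or Tail (Next a)"
| "xnf (Until a b) = Or (xnf b) (And (xnf a) (And (Neg Tail) (Next (Until a b))))"
| "xnf (Release a b) = And (xnf b) (Or (xnf a) (Or Tail (Next (Release a b))))"
| "xnf (Neg TT) = FF"
| "xnf (Neg FF) = TT"
| "xnf (Neg (Atom p)) = Neg (Atom p)"
| "xnf (Neg Tail) = Neg Tail"
| "xnf (Neg (Neg a)) = xnf a"
| "xnf (Neg (And a b)) = Or (xnf (Neg a)) (xnf (Neg b))"
| "xnf (Neg (Or a b)) = And (xnf (Neg a)) (xnf (Neg b))"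
| "xnf (Neg (Next a)) = Or Tail (Next (Neg a))"
| "xnf (Neg (WNext a)) = And (Neg Tail) (Next (Neg a))"
| "xnf (Neg (Until a b)) =
     And (xnf (Neg b)) (Or (xnf (Neg a)) (Or Tail (Next (Neg (Until a b)))))"
| "xnf (Neg (Release a b)) =
     Or (xnf (Neg b)) (And (xnf (Neg a)) (And (Neg Tail) (Next (Neg (Release a b)))))"

(* The conjunction over a finite set, taken in some unspecified order; the order
   does not affect which assignments satisfy its propositional abstraction. *)
definition xnf_set :: "'a ltlf set \<Rightarrow> 'a ltlf" where
  "xnf_set s = foldr And (map xnf (SOME \<psi>s. distinct \<psi>s \<and> set \<psi>s = s)) TT"

datatype (pvars: 'v) pform =
    PTrue
  | PFalse
  | PVar 'v
  | PNot "'v pform"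
  | PAnd "'v pform" "'v pform"
  | POr "'v pform" "'v pform"

(* An assignment is given by the set of variables it makes true. *)
primrec psat :: "'v set \<Rightarrow> 'v pform \<Rightarrow> bool" where
  "psat A PTrue \<longleftrightarrow> True"
| "psat A PFalse \<longleftrightarrow> False"
| "psat A (PVar v) \<longleftrightarrow> v \<in> A"
| "psat A (PNot f) \<longleftrightarrow> \<not> psat A f"
| "psat A (PAnd f g) \<longleftrightarrow> psat A f \<and> psat A g"
| "psat A (POr f g) \<longleftrightarrow> psat A f \<or> psat A g"

(* Assignments range over the variables that occur in the formula, so other
   Next-variables cannot put spurious formulas into a next state. *)
definition sat_assignment :: "'v set \<Rightarrow> 'v pform \<Rightarrow> bool" where
  "sat_assignment A f \<longleftrightarrow> A \<subseteq> pvars f \<and> psat A f"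

(* The Boolean variable of a formula is the formula itself.  The last three
   equations are only for totality: by xnf_pvars below, they are never used on
   a formula in the image of xnf. *)
primrec pabs :: "'a ltlf \<Rightarrow> 'a ltlf pform" where
  "pabs TT = PTrue"
| "pabs FF = PFalse"
| "pabs (Atom p) = PVar (Atom p)"
| "pabs Tail = PVar Tail"
| "pabs (Neg a) = PNot (pabs a)"
| "pabs (And a b) = PAnd (pabs a) (pabs b)"
| "pabs (Or a b) = POr (pabs a) (pabs b)"
| "pabs (Next a) = PVar (Next a)"
| "pabs (WNext a) = PVar (WNext a)"
| "pabs (Until a b) = PVar (Until a b)"
| "pabs (Release a b) = PVar (Release a b)"

primrec subf :: "'a ltlf \<Rightarrow> 'a ltlf set" where
  "subf TT = {TT}"
| "subf FF = {FF}"
| "subf (Atom p) = {Atom p}"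
| "subf Tail = {Tail}"
| "subf (Neg a) = insert (Neg a) (subf a)"
| "subf (And a b) = insert (And a b) (subf a \<union> subf b)"
| "subf (Or a b) = insert (Or a b) (subf a \<union> subf b)"
| "subf (Next a) = insert (Next a) (subf a)"
| "subf (WNext a) = insert (WNext a) (subf a)"
| "subf (Until a b) = insert (Until a b) (subf a \<union> subf b)"
| "subf (Release a b) = insert (Release a b) (subf a \<union> subf b)"

(* xnf creates obligations Next (Neg a), so negated subformulas are included. *)
definition states :: "'a ltlf \<Rightarrow> 'a ltlf set set" where
  "states \<phi> = Pow (subf \<phi> \<union> Neg ` subf \<phi>)"

definition init :: "'a ltlf \<Rightarrow> 'a ltlf set" where
  "init \<phi> = {\<phi>}"

definition next_state :: "'a ltlf set \<Rightarrow> 'a ltlf set \<Rightarrow> bool" where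
  "next_state s s' \<longleftrightarrow>
     (\<exists>A. sat_assignment A (pabs (xnf_set s)) \<and> s' = {\<chi>. Next \<chi> \<in> A})"

definition final :: "'a ltlf set \<Rightarrow> bool" where
  "final s \<longleftrightarrow> (\<exists>A. sat_assignment A (pabs (And Tail (xnf_set s))))"

definition conflict_sequence :: "'a ltlf \<Rightarrow> 'a ltlf set set list \<Rightarrow> bool" where
  "conflict_sequence \<phi> C \<longleftrightarrow>
     C \<noteq> [] \<and>
     (\<forall>i<length C. C ! i \<subseteq> states \<phi>) \<and>
     (\<forall>i<length C. init \<phi> \<in> C ! i) \<and>
     (\<forall>s\<in>C ! 0. \<not> final s) \<and>
     (\<forall>i. i + 1 < length C \<longrightarrow>
        (\<forall>s\<in>C ! (i + 1). \<forall>s'. next_state s s' \<longrightarrow> s' \<in> C ! i))"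

lemma sat_Until_unfold:
  assumes "\<xi> \<noteq> []"
  shows "sat \<xi> (Until a b) \<longleftrightarrow> sat \<xi> b \<or> sat \<xi> a \<and> sat \<xi> (Next (Until a b))"
proof -
  obtain x xs where \<xi>: "\<xi> = x # xs" using assms by (cases \<xi>) auto
  show ?thesis
    unfolding \<xi> by (cases xs) (auto simp: Ex_less_Suc2 All_less_Suc2)
qed

lemma sat_Release_unfold:
  assumes "\<xi> \<noteq> []"
  shows "sat \<xi> (Release a b) \<longleftrightarrow> sat \<xi> b \<and> (sat \<xi> a \<or> sat \<xi> (WNext (Release a b)))"
proof -
  obtain x xs where \<xi>: "\<xi> = x # xs" using assms by (cases \<xi>) auto
  show ?thesis
    unfolding \<xi> by (cases xs) (auto simp: Ex_less_Suc2 All_less_Suc2)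
qed

lemma sat_xnf:
  assumes "\<xi> \<noteq> []"
  shows "sat \<xi> (xnf \<psi>) \<longleftrightarrow> sat \<xi> \<psi>"
proof -
  have "length \<xi> = 1 \<longleftrightarrow> \<not> 1 < length \<xi>" using assms by (cases \<xi>) auto
  then show ?thesis
    by (induction \<psi> rule: xnf.induct)
      (auto simp: sat_Until_unfold[OF assms] sat_Release_unfold[OF assms]
        simp del: sat.simps(10,11))
qed

lemma xnf_pvars: "pvars (pabs (xnf \<psi>)) \<subseteq> range Atom \<union> {Tail} \<union> range Next"
  by (induction \<psi> rule: xnf.induct) auto

lemma finite_subf: "finite (subf \<phi>)"
  by (induction \<phi>) auto

lemma subf_refl: "\<phi> \<in> subf \<phi>"
  by (cases \<phi>) auto

lemma subf_trans: "\<psi> \<in> subf \<phi> \<Longrightarrow> subf \<psi> \<subseteq> subf \<phi>"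
  by (induction \<phi>) auto

lemma finite_states: "finite (states \<phi>)"
  by (simp add: states_def finite_subf)

lemma init_in_states: "init \<phi> \<in> states \<phi>"
  by (simp add: init_def states_def subf_refl)

lemma xnf_Next_closed:
  assumes "Next \<chi> \<in> pvars (pabs (xnf \<psi>))" and "\<psi> \<in> subf \<phi> \<union> Neg ` subf \<phi>"
  shows "\<chi> \<in> subf \<phi> \<union> Neg ` subf \<phi>"
proof -
  have closed:
    "Neg a \<in> subf \<phi> \<Longrightarrow> a \<in> subf \<phi>"
    "And a b \<in> subf \<phi> \<Longrightarrow> a \<in> subf \<phi> \<and> b \<in> subf \<phi>"
    "Or a b \<in> subf \<phi> \<Longrightarrow> a \<in> subf \<phi> \<and> b \<in> subf \<phi>"
    "Next a \<in> subf \<phi> \<Longrightarrow> a \<in> subf \<phi>"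
    "WNext a \<in> subf \<phi> \<Longrightarrow> a \<in> subf \<phi>"
    "Until a b \<in> subf \<phi> \<Longrightarrow> a \<in> subf \<phi> \<and> b \<in> subf \<phi>"
    "Release a b \<in> subf \<phi> \<Longrightarrow> a \<in> subf \<phi> \<and> b \<in> subf \<phi>" for a b
    by (auto dest!: subf_trans simp: subf_refl subset_iff)
  define S where "S = subf \<phi> \<union> Neg ` subf \<phi>"
  have S:
    "And a b \<in> S \<Longrightarrow> a \<in> S \<and> b \<in> S"
    "Or a b \<in> S \<Longrightarrow> a \<in> S \<and> b \<in> S"
    "Next a \<in> S \<Longrightarrow> a \<in> S"
    "WNext a \<in> S \<Longrightarrow> a \<in> S"
    "Until a b \<in> S \<Longrightarrow> a \<in> S \<and> b \<in> S"
    "Release a b \<in> S \<Longrightarrow> a \<in> S \<and> b \<in> S"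
    "Neg (Neg a) \<in> S \<Longrightarrow> a \<in> S"
    "Neg (And a b) \<in> S \<Longrightarrow> Neg a \<in> S \<and> Neg b \<in> S"
    "Neg (Or a b) \<in> S \<Longrightarrow> Neg a \<in> S \<and> Neg b \<in> S"
    "Neg (Next a) \<in> S \<Longrightarrow> Neg a \<in> S"
    "Neg (WNext a) \<in> S \<Longrightarrow> Neg a \<in> S"
    "Neg (Until a b) \<in> S \<Longrightarrow> Neg a \<in> S \<and> Neg b \<in> S"
    "Neg (Release a b) \<in> S \<Longrightarrow> Neg a \<in> S \<and> Neg b \<in> S" for a b
    unfolding S_def using closed by blast+
  show ?thesis
    using assms unfolding S_def[symmetric]
    by (induction \<psi> rule: xnf.induct) (auto dest: S)
qed

lemma pvars_xnf_set:
  assumes "finite s"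
  shows "pvars (pabs (xnf_set s)) = (\<Union>\<psi>\<in>s. pvars (pabs (xnf \<psi>)))"
proof -
  let ?xs = "SOME \<psi>s. distinct \<psi>s \<and> set \<psi>s = s"
  have "set ?xs = s"
    using someI_ex[of "\<lambda>\<psi>s. distinct \<psi>s \<and> set \<psi>s = s"] finite_distinct_list[OF assms]
    by blast
  moreover have "pvars (pabs (foldr And (map xnf xs) TT)) = (\<Union>\<psi>\<in>set xs. pvars (pabs (xnf \<psi>)))"
    for xs :: "'a ltlf list"
    by (induction xs) auto
  ultimately show ?thesis by (simp add: xnf_set_def)
qed

lemma next_state_in_states:
  assumes "s \<in> states \<phi>" and "next_state s s'"
  shows "s' \<in> states \<phi>"
proof -
  have "finite s"
    using assms(1) by (auto simp: states_def finite_subf intro: finite_subset)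
  with assms xnf_Next_closed show ?thesis
    by (fastforce simp: states_def next_state_def sat_assignment_def pvars_xnf_set)
qed

end

(* A finite set of formulas holds on some nonempty trace iff a final state is
   reachable from it: a trace is peeled off position by position, and conversely
   a run is read backwards, each assignment giving one letter of the trace.  This
   works because Next occurs only positively in xnf, and because an assignment
   that makes Tail true already shows its own state to be final.
   If phi is unsatisfiable, the set R of reachable states gives the conflict
   sequence R, R.  Conversely, if the intersection of C[0], ..., C[i] is included
   in C[i+1], then this intersection is closed under transitions, so it contains
   all reachable states, and none of them is final. *)
theory Submission
  imports Defs
begin

lemma psat_pvars_cong:
  assumes "\<And>v. v \<in> pvars f \<Longrightarrow> v \<in> A \<longleftrightarrow> v \<in> B"
  shows "psat A f \<longleftrightarrow> psat B f"
  using assms by (induction f) auto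

lemma finite_pvars: "finite (pvars f)"
  by (induction f) auto

text \<open>Each variable of the abstraction is itself a formula, so a trace induces an assignment;
  \<open>Next\<close>, \<open>WNext\<close>, \<open>Until\<close> and \<open>Release\<close> stay
  opaque in the induction.\<close>

lemma psat_pabs_true_subformulas: "psat {v. sat \<xi> v} (pabs \<theta>) \<longleftrightarrow> sat \<xi> \<theta>"
  by (induction \<theta>) (simp_all del: sat.simps(8-11))

lemma sat_assignment_of_trace:
  assumes "sat \<xi> \<theta>"
  shows "sat_assignment {v \<in> pvars (pabs \<theta>). sat \<xi> v} (pabs \<theta>)"
proof -
  have "psat {v \<in> pvars (pabs \<theta>). sat \<xi> v} (pabs \<theta>) \<longleftrightarrow> psat {v. sat \<xi> v} (pabs \<theta>)"
    by (rule psat_pvars_cong) auto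
  with assms show ?thesis
    by (simp add: sat_assignment_def psat_pabs_true_subformulas)
qed

lemma set_xnf_set_order:
  assumes "finite s"
  shows "set (SOME \<psi>s. distinct \<psi>s \<and> set \<psi>s = s) = s"
  using someI_ex[OF finite_distinct_list[OF assms, unfolded conj_commute[of "set _ = s"]]] by blast

lemma psat_xnf_set:
  assumes "finite s"
  shows "psat A (pabs (xnf_set s)) \<longleftrightarrow> (\<forall>\<psi>\<in>s. psat A (pabs (xnf \<psi>)))"
proof -
  have "psat A (pabs (foldr And (map xnf xs) TT)) \<longleftrightarrow> (\<forall>\<psi>\<in>set xs. psat A (pabs (xnf \<psi>)))" for xs
    by (induction xs) auto
  then show ?thesis by (simp add: xnf_set_def set_xnf_set_order[OF assms])
qed

lemma sat_xnf_set:
  assumes "finite s" and "\<xi> \<noteq> []"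
  shows "sat \<xi> (xnf_set s) \<longleftrightarrow> (\<forall>\<psi>\<in>s. sat \<xi> \<psi>)"
proof -
  have "sat \<xi> (foldr And (map xnf xs) TT) \<longleftrightarrow> (\<forall>\<psi>\<in>set xs. sat \<xi> \<psi>)" for xs
    by (induction xs) (auto simp: sat_xnf[OF assms(2)])
  then show ?thesis by (simp add: xnf_set_def set_xnf_set_order[OF assms(1)])
qed

text \<open>Finiteness has to be carried along runs, since the enumeration chosen in
  \<open>xnf_set\<close> exists only for a finite set.\<close>

lemma finite_next_state:
  assumes "next_state s s'"
  shows "finite s'"
proof -
  obtain A where A: "A \<subseteq> pvars (pabs (xnf_set s))" and s': "s' = Next -` A"
    using assms by (auto simp: next_state_def sat_assignment_def vimage_def)
  then show ?thesis
    using finite_subset[OF A finite_pvars] by (auto intro!: finite_vimageI injI)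
qed

text \<open>\<open>Tail\<close> occurs in both polarities, so \<open>A\<close> must be exact on it;
  \<open>Next\<close> occurs only positively, so one implication suffices. If \<open>xs\<close> is
  empty, the \<open>Next\<close> variables are unconstrained, but their guards make them irrelevant:
  \<open>And (Neg Tail) _\<close> is false and \<open>Or Tail _\<close> is true.\<close>

lemma sat_of_psat_xnf:
  assumes "psat A (pabs (xnf \<psi>))"
    and "Tail \<in> A \<longleftrightarrow> xs = []"
    and "\<And>\<chi>. Next \<chi> \<in> A \<Longrightarrow> xs \<noteq> [] \<Longrightarrow> sat xs \<chi>"
  shows "sat ({p. Atom p \<in> A} # xs) \<psi>"
proof -
  have "sat ({p. Atom p \<in> A} # xs) (Next \<chi>)" if "Next \<chi> \<in> A" "xs \<noteq> []" for \<chi>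
    using assms(3) that by simp
  with assms(1,2) have "sat ({p. Atom p \<in> A} # xs) (xnf \<psi>)"
    by (induction \<psi> rule: xnf.induct) (auto simp del: sat.simps(8))
  then show ?thesis by (simp add: sat_xnf)
qed

lemma final_reachable_if_sat:
  assumes "finite s" and "\<xi> \<noteq> []" and "\<forall>\<psi>\<in>s. sat \<xi> \<psi>"
  shows "\<exists>t. next_state\<^sup>*\<^sup>* s t \<and> final t"
  using assms
proof (induction \<xi> arbitrary: s)
  case (Cons x xs)
  have sat_s: "sat (x # xs) (xnf_set s)"
    using Cons.prems by (simp add: sat_xnf_set)
  show ?case
  proof (cases "xs = []")
    case True
    then have "sat (x # xs) (And Tail (xnf_set s))" using sat_s by simp
    then have "final s" unfolding final_def by (blast dest: sat_assignment_of_trace)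
    then show ?thesis by blast
  next
    case False
    \<comment> \<open>With this assignment, the obligations recorded in \<open>s'\<close> are
      next-formulas true on the whole trace, hence their arguments hold on
      \<open>xs\<close>.\<close>
    define A where "A = {v \<in> pvars (pabs (xnf_set s)). sat (x # xs) v}"
    define s' where "s' = {\<chi>. Next \<chi> \<in> A}"
    have step: "next_state s s'"
      unfolding next_state_def s'_def A_def using sat_assignment_of_trace[OF sat_s] by blast
    have "\<forall>\<chi>\<in>s'. sat xs \<chi>"
      by (simp add: s'_def A_def)
    then obtain t where "next_state\<^sup>*\<^sup>* s' t" "final t"
      using Cons.IH[OF finite_next_state[OF step] False] by blast
    with step show ?thesis by (meson converse_rtranclp_into_rtranclp)
  qed
qed simp

lemma sat_if_final:
  assumes "finite s" and "psat A (pabs (xnf_set s))" and "Tail \<in> A"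
  shows "\<exists>\<xi>. \<xi> \<noteq> [] \<and> (\<forall>\<psi>\<in>s. sat \<xi> \<psi>)"
proof -
  have "\<forall>\<psi>\<in>s. sat [{p. Atom p \<in> A}] \<psi>"
    using assms sat_of_psat_xnf[of A _ "[]"] by (simp add: psat_xnf_set)
  then show ?thesis by blast
qed

lemma sat_if_final_reachable:
  assumes "next_state\<^sup>*\<^sup>* s t" and "final t" and "finite s"
  shows "\<exists>\<xi>. \<xi> \<noteq> [] \<and> (\<forall>\<psi>\<in>s. sat \<xi> \<psi>)"
  using assms
proof (induction rule: converse_rtranclp_induct)
  case base
  then show ?case by (auto simp: final_def sat_assignment_def intro: sat_if_final)
next
  case (step s s')
  obtain A where A: "psat A (pabs (xnf_set s))" and s': "s' = {\<chi>. Next \<chi> \<in> A}"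
    using step.hyps(1) by (auto simp: next_state_def sat_assignment_def)
  show ?case
  \<comment> \<open>A transition may set \<open>Tail\<close> to true. The rest of the run is then
    discarded, and the single letter read off \<open>A\<close> is already a model of
    \<open>s\<close>.\<close>
  proof (cases "Tail \<in> A")
    case True
    then show ?thesis using sat_if_final[OF step.prems(2) A] by blast
  next
    case False
    obtain \<xi> where "\<xi> \<noteq> []" and "\<forall>\<chi>\<in>s'. sat \<xi> \<chi>"
      using step.IH[OF step.prems(1) finite_next_state[OF step.hyps(1)]] by blast
    then have "\<forall>\<psi>\<in>s. sat ({p. Atom p \<in> A} # \<xi>) \<psi>"
      using A False step.prems(2) by (auto simp: psat_xnf_set s' intro!: sat_of_psat_xnf)
    then show ?thesis by blast
  qed
qed

text \<open>Used to cut a model built from assignments, whose letters have not been confined to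
  \<open>P\<close>, down to the traces that \<open>satisfiable\<close> admits.\<close>

lemma sat_restrict_letters:
  assumes "atoms \<psi> \<subseteq> P" and "\<xi> \<noteq> []"
  shows "sat (map (\<lambda>a. a \<inter> P) \<xi>) \<psi> \<longleftrightarrow> sat \<xi> \<psi>"
  using assms
proof (induction \<psi> arbitrary: \<xi>)
  case (Until a b)
  then show ?case by (auto simp: drop_map intro!: ex_cong1 conj_cong all_cong1 imp_cong)
next
  case (Release a b)
  then show ?case by (auto simp: drop_map intro!: ex_cong1 conj_cong all_cong1 imp_cong)
qed (auto simp: drop_map)

lemma satisfiable_iff_final_reachable:
  assumes "atoms \<phi> \<subseteq> P"
  shows "satisfiable P \<phi> \<longleftrightarrow> (\<exists>t. next_state\<^sup>*\<^sup>* (init \<phi>) t \<and> final t)"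
proof
  assume "satisfiable P \<phi>"
  then show "\<exists>t. next_state\<^sup>*\<^sup>* (init \<phi>) t \<and> final t"
    by (auto simp: satisfiable_def init_def intro: final_reachable_if_sat)
next
  assume "\<exists>t. next_state\<^sup>*\<^sup>* (init \<phi>) t \<and> final t"
  then obtain \<xi> where "\<xi> \<noteq> []" and "sat \<xi> \<phi>"
    using sat_if_final_reachable[of "init \<phi>"] by (auto simp: init_def)
  then have "map (\<lambda>a. a \<inter> P) \<xi> \<noteq> [] \<and> set (map (\<lambda>a. a \<inter> P) \<xi>) \<subseteq> Pow P
      \<and> sat (map (\<lambda>a. a \<inter> P) \<xi>) \<phi>"
    using sat_restrict_letters[OF assms] by auto
  then show "satisfiable P \<phi>" unfolding satisfiable_def by blast
qed

lemma conflict_sequence_reachable: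
  assumes "\<And>t. next_state\<^sup>*\<^sup>* (init \<phi>) t \<Longrightarrow> \<not> final t"
  defines "R \<equiv> {t. next_state\<^sup>*\<^sup>* (init \<phi>) t}"
  shows "conflict_sequence \<phi> [R, R]"
proof -
  have "t \<in> states \<phi>" if "next_state\<^sup>*\<^sup>* (init \<phi>) t" for t
    using that by induction (auto intro: init_in_states next_state_in_states)
  then have "R \<subseteq> states \<phi>" by (auto simp: R_def)
  moreover have "s' \<in> R" if "s \<in> R" and "next_state s s'" for s s'
    using that unfolding R_def by (auto intro: rtranclp.rtrancl_into_rtrancl)
  ultimately show ?thesis
    using assms by (auto simp: conflict_sequence_def less_Suc_eq nth_Cons')
qed

lemma conflict_sequence_not_final:
  assumes C: "conflict_sequence \<phi> C" and i: "i + 1 < length C"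
    and sub: "(\<Inter>j\<in>{0..i}. C ! j) \<subseteq> C ! (i + 1)"
    and reach: "next_state\<^sup>*\<^sup>* (init \<phi>) t"
  shows "\<not> final t"
proof -
  have "t \<in> (\<Inter>j\<in>{0..i}. C ! j)"
    using reach
  proof induction
    case base
    show ?case using C i by (auto simp: conflict_sequence_def)
  next
    case (step s s')
    have "s' \<in> C ! j" if "j \<le> i" for j
    proof -
      \<comment> \<open>A transition lowers the index by one. For j < i the set
        \<open>C ! (j + 1)\<close> is one of those intersected; for j = i the inclusion
        \<open>sub\<close> supplies membership.\<close>
      have "s \<in> C ! (j + 1)"
        using step.IH sub that by (cases "j = i") auto
      then show ?thesis
        using C i that step.hyps(2) by (auto simp: conflict_sequence_def)
    qed
    then show ?case by auto
  qed
  then have "t \<in> C ! 0" by auto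
  then show ?thesis using C by (auto simp: conflict_sequence_def)
qed

theorem mainTheorem3:
  fixes P :: "'a set" and \<phi> :: "'a ltlf"
  assumes "finite P" and "atoms \<phi> \<subseteq> P"
  shows "\<not> satisfiable P \<phi> \<longleftrightarrow>
    (\<exists>C i. conflict_sequence \<phi> C \<and> i + 1 < length C \<and>
       (\<Inter>j\<in>{0..i}. C ! j) \<subseteq> C ! (i + 1))"
proof
  assume "\<not> satisfiable P \<phi>"
  then have "conflict_sequence \<phi> [{t. next_state\<^sup>*\<^sup>* (init \<phi>) t}, {t. next_state\<^sup>*\<^sup>* (init \<phi>) t}]"
    by (intro conflict_sequence_reachable)
      (auto simp: satisfiable_iff_final_reachable[OF assms(2)])
  then show "\<exists>C i. conflict_sequence \<phi> C \<and> i + 1 < length C \<and>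
      (\<Inter>j\<in>{0..i}. C ! j) \<subseteq> C ! (i + 1)"
    \<comment> \<open>For i = 0 the intersection is just the first entry, which equals the
      second.\<close>
    by (intro exI[of _ "[_, _]"] exI[of _ 0]) auto
next
  assume "\<exists>C i. conflict_sequence \<phi> C \<and> i + 1 < length C \<and>
      (\<Inter>j\<in>{0..i}. C ! j) \<subseteq> C ! (i + 1)"
  then show "\<not> satisfiable P \<phi>"
    using conflict_sequence_not_final
    by (auto simp: satisfiable_iff_final_reachable[OF assms(2)] simp del: INT_subset_iff)
qed

end
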